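(* Let $\mathcal P$ be a class of $p$-value dependence structures and let $\mathcal P_0=\{P_0:P\in\mathcal P\}$ be the induced class of null dependence structures. If $\mathcal P_0$ is FDR-consistent, then $\mathcal P$ is also FDR-consistent.
   Context: A $p$-value dependence structure $P$ consists of an integer $n\ge1$, a null set $\mathcal N_0\subset\{1,\dots,n\}$ of size $n_0\ge1$, and a joint probability distribution on $[0,1]^n$ of $p$-values $(p_1,\dots,p_n)$ such that each null $p$-value $p_i$, $i\in\mathcal N_0$, is stochastically larger than or equal to the uniform variable on $(0,1)$. Different elements of a class $\mathcal P$ may have different $n$ and $\mathcal N_0$. For $P\in\mathcal P$, $P_0$ is the induced joint distribution of the null components $(p_i)_{i\in\mathcal N_0}$ on $[0,1]^{n_0}$, regarded as a dependence structure of $n_0$ $p$-values all of which are null. BH procedure at level $\alpha\in(0,1)$ on $m$ $p$-values with order statistics $q_{(1)}\le\cdots\le q_{(m)}$: let $R=\max\{1\le j\le m:q_{(j)}\le\alpha j/m\}$ ($\max\emptyset=0$) and reject the $R$ hypotheses with $p$-values at most $\alpha R/m$ (none if $R=0$). With $V$ the number of rejected null $p$-values, $\mathrm{FDR}=\mathbb E[V/\max\{R,1\}]$. $\mathrm{FDR}(\alpha;P)$ denotes the FDR of the BH procedure at level $\alpha$ applied to $p$-values sampled from $P$. A class $\mathcal P$ is FDR-consistent if $\limsup_{\alpha\to0}\sup_{P\in\mathcal P}\mathrm{FDR}(\alpha;P)=0$. *)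

theory Defs
  imports "HOL-Probability.Probability"
begin

definition unit_cube :: "nat \<Rightarrow> (nat \<Rightarrow> real) measure" where
  "unit_cube n = (\<Pi>\<^sub>M i\<in>{1..n}. restrict_space borel {0..1})"

definition order_stat :: "nat \<Rightarrow> (nat \<Rightarrow> real) \<Rightarrow> nat \<Rightarrow> real" where
  "order_stat m q j = sort (map q [1..<Suc m]) ! (j - 1)"

definition BH_R :: "real \<Rightarrow> nat \<Rightarrow> (nat \<Rightarrow> real) \<Rightarrow> nat" where
  "BH_R \<alpha> m q = Max (insert 0 {j \<in> {1..m}. order_stat m q j \<le> \<alpha> * real j / real m})"

definition BH_rejected :: "real \<Rightarrow> nat \<Rightarrow> (nat \<Rightarrow> real) \<Rightarrow> nat set" where
  "BH_rejected \<alpha> m q =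
     (if BH_R \<alpha> m q = 0 then {} else {i \<in> {1..m}. q i \<le> \<alpha> * real (BH_R \<alpha> m q) / real m})"

definition FDP :: "real \<Rightarrow> nat \<Rightarrow> nat set \<Rightarrow> (nat \<Rightarrow> real) \<Rightarrow> real" where
  "FDP \<alpha> m N q = real (card (BH_rejected \<alpha> m q \<inter> N)) / real (max (BH_R \<alpha> m q) 1)"

record pval_struct =
  size_of :: nat
  nulls :: "nat set"
  law :: "(nat \<Rightarrow> real) measure"

definition st_le :: "real measure \<Rightarrow> real measure \<Rightarrow> bool" where
  "st_le \<mu> \<nu> \<longleftrightarrow> (\<forall>t. cdf \<nu> t \<le> cdf \<mu> t)"

definition pval_structure :: "pval_struct \<Rightarrow> bool" where
  "pval_structure P \<longleftrightarrow>
     size_of P \<ge> 1 \<and> nulls P \<subseteq> {1..size_of P} \<and> nulls P \<noteq> {} \<and>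
     prob_space (law P) \<and> sets (law P) = sets (unit_cube (size_of P)) \<and>
     (\<forall>i\<in>nulls P. st_le (uniform_measure lborel {0<..<1}) (distr (law P) borel (\<lambda>p. p i)))"

definition FDR :: "real \<Rightarrow> pval_struct \<Rightarrow> real" where
  "FDR \<alpha> P = (\<integral>p. FDP \<alpha> (size_of P) (nulls P) p \<partial>law P)"

(* The null indices are renumbered increasingly as 1, ..., n0. *)
definition null_coords :: "nat set \<Rightarrow> (nat \<Rightarrow> real) \<Rightarrow> (nat \<Rightarrow> real)" where
  "null_coords N p = (\<lambda>k\<in>{1..card N}. p (sorted_list_of_set N ! (k - 1)))"

definition null_struct :: "pval_struct \<Rightarrow> pval_struct" where
  "null_struct P =
     \<lparr>size_of = card (nulls P), nulls = {1..card (nulls P)},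
      law = distr (law P) (unit_cube (card (nulls P))) (null_coords (nulls P))\<rparr>"

(* The supremum is taken in the extended nonnegative reals, so it is 0 for the empty class. *)
definition FDR_consistent :: "pval_struct set \<Rightarrow> bool" where
  "FDR_consistent C \<longleftrightarrow> Limsup (at_right 0) (\<lambda>\<alpha>. SUP P\<in>C. ennreal (FDR \<alpha> P)) = 0"

lemma null_coords_measurable:
  assumes "N \<subseteq> {1..n}"
  shows "null_coords N \<in> measurable (unit_cube n) (unit_cube (card N))"
proof -
  have fin: "finite N" using assms finite_subset by blast
  have mem: "sorted_list_of_set N ! (k - 1) \<in> {1..n}" if "k \<in> {1..card N}" for k
  proof -
    have "k - 1 < length (sorted_list_of_set N)" using that by auto
    then have "sorted_list_of_set N ! (k - 1) \<in> N"
      using fin nth_mem set_sorted_list_of_set by blast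
    then show ?thesis using assms by blast
  qed
  show ?thesis
    unfolding null_coords_def unit_cube_def
    by (intro measurable_restrict measurable_component_singleton mem)
qed

lemma pval_structure_null_struct:
  assumes "pval_structure P"
  shows "pval_structure (null_struct P)"
proof -
  let ?N = "nulls P" and ?n = "size_of P"
  have sub: "?N \<subseteq> {1..?n}" and ne: "?N \<noteq> {}" and ps: "prob_space (law P)"
    and sets: "sets (law P) = sets (unit_cube ?n)"
    and st: "\<And>i. i \<in> ?N \<Longrightarrow> st_le (uniform_measure lborel {0<..<1}) (distr (law P) borel (\<lambda>p. p i))"
    using assms by (auto simp: pval_structure_def)
  have fin: "finite ?N" using sub finite_subset by blast
  have meas: "null_coords ?N \<in> measurable (law P) (unit_cube (card ?N))"
    using null_coords_measurable[OF sub] measurable_cong_sets[OF sets refl] by blast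
  have st0: "st_le (uniform_measure lborel {0<..<1})
      (distr (distr (law P) (unit_cube (card ?N)) (null_coords ?N)) borel (\<lambda>p. p k))"
    if k: "k \<in> {1..card ?N}" for k
  proof -
    let ?i = "sorted_list_of_set ?N ! (k - 1)"
    have "k - 1 < length (sorted_list_of_set ?N)" using k by auto
    then have i: "?i \<in> ?N" using fin nth_mem set_sorted_list_of_set by blast
    have "(\<lambda>p. p k) \<in> measurable (unit_cube (card ?N)) (restrict_space borel {0..1::real})"
      unfolding unit_cube_def using k by (rule measurable_component_singleton)
    then have mk: "(\<lambda>p. p k) \<in> borel_measurable (unit_cube (card ?N))"
      by (rule measurable_restrict_space2_iff[THEN iffD1, THEN conjunct1])
    have "distr (distr (law P) (unit_cube (card ?N)) (null_coords ?N)) borel (\<lambda>p. p k)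
        = distr (law P) borel (\<lambda>p. p ?i)"
      using k by (simp add: distr_distr[OF mk meas] comp_def null_coords_def)
    then show ?thesis using st[OF i] by simp
  qed
  show ?thesis
    using ne fin st0 prob_space.prob_space_distr[OF ps meas]
    by (simp add: pval_structure_def null_struct_def Suc_le_eq card_gt_0_iff)
qed

end

theory Submission
  imports Defs
begin

text \<open>
  If the false discovery proportion \<open>V / R\<close> exceeds \<open>\<epsilon>\<close>, then \<open>V\<close> null p-values lie below
  \<open>\<alpha> R / n \<le> (\<alpha> / \<epsilon>) V / n\<^sub>0\<close>, so BH at level \<open>\<alpha> / \<epsilon>\<close> applied to the null p-values alone rejects
  something. Since the FDR of an all-null structure is the probability of rejecting anything, the
  FDR at level \<open>\<alpha>\<close> is at most \<open>\<epsilon>\<close> plus the FDR of the null structure at level \<open>\<alpha> / \<epsilon>\<close>. Taking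
  \<open>\<epsilon> = sqrt \<alpha>\<close> makes both terms vanish in the limit, uniformly over the class.
\<close>

section \<open>Order statistics as counts\<close>

text \<open>In a sorted list the entries at most \<open>c\<close> form a prefix.\<close>

lemma sorted_nth_le_iff:
  fixes xs :: "'a :: linorder list"
  assumes "sorted xs" "k < length xs"
  shows "xs ! k \<le> c \<longleftrightarrow> k < length (filter (\<lambda>x. x \<le> c) xs)"
  using assms
proof (induction xs arbitrary: k)
  case Nil
  then show ?case by simp
next
  case (Cons x xs)
  show ?case
  proof (cases "x \<le> c")
    case True
    then show ?thesis using Cons by (cases k) auto
  next
    case False
    then have "\<not> y \<le> c" if "y \<in> set (x # xs)" for y
      using Cons.prems(1) that by auto
    moreover have "(x # xs) ! k \<in> set (x # xs)"
      using Cons.prems(2) nth_mem by blast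
    ultimately show ?thesis by (auto simp: filter_empty_conv)
  qed
qed

lemma order_stat_le_iff:
  assumes "j \<in> {1..m}"
  shows "order_stat m q j \<le> c \<longleftrightarrow> j \<le> card {i \<in> {1..m}. q i \<le> c}"
proof -
  have "length (filter (\<lambda>x. x \<le> c) (sort (map q [1..<Suc m])))
      = length (filter (\<lambda>i. q i \<le> c) [1..<Suc m])"
    by (simp add: filter_sort filter_map comp_def del: upt_Suc)
  also have "\<dots> = card (set (filter (\<lambda>i. q i \<le> c) [1..<Suc m]))"
    by (simp only: distinct_card distinct_filter distinct_upt)
  also have "set (filter (\<lambda>i. q i \<le> c) [1..<Suc m]) = {i \<in> {1..m}. q i \<le> c}"
    by auto
  finally have len: "length (filter (\<lambda>x. x \<le> c) (sort (map q [1..<Suc m])))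
      = card {i \<in> {1..m}. q i \<le> c}" .
  have "j - 1 < length (sort (map q [1..<Suc m]))"
    using assms by auto
  \<comment> \<open>Since \<open>j\<close> is at least 1, \<open>j - 1 < N\<close> and
    \<open>j \<le> N\<close> agree despite truncated subtraction.\<close>
  from sorted_nth_le_iff[OF sorted_sort this, of c] show ?thesis
    unfolding order_stat_def len using assms by auto
qed

section \<open>The BH rejection count\<close>

lemma BH_R_eq:
  "BH_R \<alpha> m q =
    Max (insert 0 {j \<in> {1..m}. j \<le> card {i \<in> {1..m}. q i \<le> \<alpha> * real j / real m}})"
proof -
  have "{j \<in> {1..m}. order_stat m q j \<le> \<alpha> * real j / real m}
      = {j \<in> {1..m}. j \<le> card {i \<in> {1..m}. q i \<le> \<alpha> * real j / real m}}"
    using order_stat_le_iff by blast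
  then show ?thesis by (simp add: BH_R_def)
qed

lemma BH_R_ge:
  assumes "j \<in> {1..m}" "j \<le> card {i \<in> {1..m}. q i \<le> \<alpha> * real j / real m}"
  shows "j \<le> BH_R \<alpha> m q"
  unfolding BH_R_eq by (rule Max_ge) (use assms in auto)

lemma BH_R_cases:
  "BH_R \<alpha> m q = 0 \<or>
   BH_R \<alpha> m q \<in> {1..m} \<and>
   BH_R \<alpha> m q \<le> card {i \<in> {1..m}. q i \<le> \<alpha> * real (BH_R \<alpha> m q) / real m}"
proof -
  have "BH_R \<alpha> m q \<in> insert 0 {j \<in> {1..m}. j \<le> card {i \<in> {1..m}. q i \<le> \<alpha> * real j / real m}}"
    unfolding BH_R_eq by (rule Max_in) auto
  then show ?thesis by blast
qed

text \<open>Any single witness \<open>j\<close>, not necessarily the maximal one, certifies a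
  rejection. This form also makes the event visibly measurable.\<close>

lemma BH_R_pos_iff:
  "BH_R \<alpha> m q \<noteq> 0 \<longleftrightarrow>
    (\<exists>j\<in>{1..m}. j \<le> card {i \<in> {1..m}. q i \<le> \<alpha> * real j / real m})"
  using BH_R_cases[of \<alpha> m q] BH_R_ge[of _ m q \<alpha>] by fastforce

text \<open>By maximality of \<open>R\<close>: the number of p-values below the threshold of
  \<open>R\<close> is itself an admissible index, because thresholds grow with the index when
  \<alpha> is nonnegative. Hence it cannot exceed \<open>R\<close>.\<close>

lemma card_BH_rejected:
  assumes "0 \<le> \<alpha>"
  shows "card (BH_rejected \<alpha> m q) = BH_R \<alpha> m q"
proof (cases "BH_R \<alpha> m q = 0")
  case True
  then show ?thesis by (simp add: BH_rejected_def)
next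
  case False
  let ?R = "BH_R \<alpha> m q"
  let ?A = "\<lambda>j. {i \<in> {1..m}. q i \<le> \<alpha> * real j / real m}"
  have R: "?R \<in> {1..m}" "?R \<le> card (?A ?R)"
    using BH_R_cases[of \<alpha> m q] False by auto
  have "card (?A ?R) \<le> card {1..m}"
    by (rule card_mono) auto
  then have *: "card (?A ?R) \<in> {1..m}"
    using R by auto
  have "?A ?R \<subseteq> ?A (card (?A ?R))"
  proof -
    have "\<alpha> * real ?R / real m \<le> \<alpha> * real (card (?A ?R)) / real m"
      using R assms by (intro divide_right_mono mult_left_mono) auto
    then show ?thesis by auto
  qed
  then have "card (?A ?R) \<le> card (?A (card (?A ?R)))"
    by (intro card_mono) auto
  then have "card (?A ?R) \<le> ?R"
    by (rule BH_R_ge[OF *])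
  with R False show ?thesis by (simp add: BH_rejected_def)
qed

section \<open>False discovery proportions and restriction to the nulls\<close>

lemma FDP_le_1:
  assumes "0 \<le> \<alpha>"
  shows "FDP \<alpha> m N q \<le> 1"
proof -
  have "card (BH_rejected \<alpha> m q \<inter> N) \<le> card (BH_rejected \<alpha> m q)"
    by (rule card_mono) (auto simp: BH_rejected_def)
  then show ?thesis
    using card_BH_rejected[OF assms, of m q] by (simp add: FDP_def)
qed

text \<open>Here \<open>V = R\<close>, so the ratio is 1, or 0 when nothing is rejected.\<close>

lemma FDP_all_null:
  assumes "0 \<le> \<alpha>"
  shows "FDP \<alpha> m {1..m} q = of_bool (BH_R \<alpha> m q \<noteq> 0)"
proof -
  have "BH_rejected \<alpha> m q \<inter> {1..m} = BH_rejected \<alpha> m q"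
    by (auto simp: BH_rejected_def)
  then show ?thesis
    using card_BH_rejected[OF assms, of m q] by (simp add: FDP_def)
qed

text \<open>Renumbering the nulls is a bijection, so counts below a threshold are preserved.\<close>

lemma card_null_coords_le:
  assumes "finite N"
  shows "card {k \<in> {1..card N}. null_coords N p k \<le> c} = card {i \<in> N. p i \<le> c}"
proof -
  have b: "bij_betw (\<lambda>k. sorted_list_of_set N ! (k - 1)) {1..card N} N"
  proof -
    have "bij_betw (\<lambda>k. k - 1) {1..card N} {..<card N}"
      by (rule bij_betwI[where g = Suc]) auto
    moreover have "bij_betw ((!) (sorted_list_of_set N)) {..<card N} N"
      by (rule bij_betw_nth) (use assms in auto)
    ultimately show ?thesis
      using bij_betw_trans by (fastforce simp: comp_def)
  qed
  have "bij_betw (\<lambda>k. sorted_list_of_set N ! (k - 1))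
      {k \<in> {1..card N}. null_coords N p k \<le> c} {i \<in> N. p i \<le> c}"
    by (rule bij_betw_Collect[OF b]) (simp add: null_coords_def)
  then show ?thesis by (rule bij_betw_same_card)
qed

lemma FDP_le_null_rejection:
  assumes "0 < \<alpha>" "0 < \<epsilon>" "N \<subseteq> {1..n}"
  shows "FDP \<alpha> n N p \<le> \<epsilon> + of_bool (BH_R (\<alpha> / \<epsilon>) (card N) (null_coords N p) \<noteq> 0)"
proof (cases "FDP \<alpha> n N p \<le> \<epsilon>")
  case True
  then show ?thesis by (simp add: add_increasing2)
next
  case False
  define R where "R = BH_R \<alpha> n p"
  define V where "V = card (BH_rejected \<alpha> n p \<inter> N)"
  have fin: "finite N" using assms(3) finite_subset by blast
  have "V \<noteq> 0"
    using False assms(2) by (intro notI) (simp add: FDP_def V_def)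
  then have "R \<noteq> 0"
    by (auto simp: V_def R_def BH_rejected_def)
  have VR: "\<epsilon> * real R \<le> real V"
  proof -
    have "max R 1 = R"
      using \<open>R \<noteq> 0\<close> by simp
    then have "\<epsilon> < real V / real R"
      using False by (simp add: FDP_def V_def R_def)
    then show ?thesis
      using \<open>R \<noteq> 0\<close> by (simp add: field_simps)
  qed
  have "V \<le> card N"
    unfolding V_def by (rule card_mono[OF fin]) auto
  have "card N \<le> n"
    using card_mono[OF _ assms(3)] by simp
  \<comment> \<open>The numerator grows because \<open>R\<close> is at most \<open>V\<close> divided
    by \<epsilon>, and the denominator shrinks from \<open>n\<close> to
    \<open>card N\<close>.\<close>
  have le: "\<alpha> * real R / real n \<le> \<alpha> / \<epsilon> * real V / real (card N)"
  proof -
    have "\<alpha> * real R \<le> \<alpha> / \<epsilon> * real V"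
      using VR assms(1,2) by (simp add: field_simps)
    then show ?thesis
      using \<open>card N \<le> n\<close> \<open>V \<le> card N\<close> \<open>V \<noteq> 0\<close> assms(1,2) by (intro frac_le) auto
  qed
  have "V \<le> card {i \<in> N. p i \<le> \<alpha> / \<epsilon> * real V / real (card N)}"
    unfolding V_def
  proof (rule card_mono)
    show "BH_rejected \<alpha> n p \<inter> N \<subseteq>
        {i \<in> N. p i \<le> \<alpha> / \<epsilon> * real (card (BH_rejected \<alpha> n p \<inter> N)) / real (card N)}"
      using le \<open>R \<noteq> 0\<close> by (auto simp: BH_rejected_def R_def V_def)
  qed (use fin in auto)
  \<comment> \<open>The witnessing index is \<open>V\<close> itself.\<close>
  then have "BH_R (\<alpha> / \<epsilon>) (card N) (null_coords N p) \<noteq> 0"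
    unfolding BH_R_pos_iff card_null_coords_le[OF fin]
    using \<open>V \<le> card N\<close> \<open>V \<noteq> 0\<close> by (intro bexI[of _ V]) auto
  then show ?thesis
    using FDP_le_1[of \<alpha> n N p] assms(1,2) by simp
qed

section \<open>Measurability and integration\<close>

lemma measurable_BH_R_pos:
  "Measurable.pred (unit_cube m) (\<lambda>q. BH_R \<alpha> m q \<noteq> 0)"
proof -
  have [measurable]: "(\<lambda>q. q i) \<in> borel_measurable (unit_cube m)" if "i \<in> {1..m}" for i
  proof -
    have "(\<lambda>q. q i) \<in> measurable (unit_cube m) (restrict_space borel {0..1::real})"
      unfolding unit_cube_def using that by (rule measurable_component_singleton)
    then show ?thesis
      by (rule measurable_restrict_space2_iff[THEN iffD1, THEN conjunct1])
  qed
  \<comment> \<open>As a finite sum of indicators, the count is measurable in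
    \<open>q\<close>.\<close>
  have eq: "real (card {i \<in> {1..m}. q i \<le> c}) = (\<Sum>i\<in>{1..m}. of_bool (q i \<le> c))"
    for q :: "nat \<Rightarrow> real" and c
    by (simp add: Int_def)
  have "BH_R \<alpha> m q \<noteq> 0 \<longleftrightarrow>
      (\<exists>j\<in>{1..m}. real j \<le> (\<Sum>i\<in>{1..m}. of_bool (q i \<le> \<alpha> * real j / real m)))" for q
    unfolding BH_R_pos_iff eq[symmetric] by simp
  then show ?thesis
    unfolding of_bool_def by simp measurable
qed

lemma FDR_le_null_struct:
  assumes "pval_structure P" "0 < \<alpha>" "0 < \<epsilon>"
  shows "FDR \<alpha> P \<le> \<epsilon> + FDR (\<alpha> / \<epsilon>) (null_struct P)"
proof -
  let ?N = "nulls P" and ?n = "size_of P"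
  let ?F = "\<lambda>q. of_bool (BH_R (\<alpha> / \<epsilon>) (card ?N) q \<noteq> 0) :: real"
  interpret prob_space "law P"
    using assms(1) by (simp add: pval_structure_def)
  have sub: "?N \<subseteq> {1..?n}" and sets: "sets (law P) = sets (unit_cube ?n)"
    using assms(1) by (auto simp: pval_structure_def)
  have meas: "null_coords ?N \<in> measurable (law P) (unit_cube (card ?N))"
    using null_coords_measurable[OF sub] measurable_cong_sets[OF sets refl] by blast
  have F: "?F \<in> borel_measurable (unit_cube (card ?N))"
    using measurable_BH_R_pos unfolding of_bool_def by measurable
  have int: "integrable (law P) (\<lambda>p. ?F (null_coords ?N p))"
    by (rule integrable_const_bound[of _ 1]) (use measurable_compose[OF meas F] in auto)
  have "FDR \<alpha> P \<le> (\<integral>p. \<epsilon> + ?F (null_coords ?N p) \<partial>law P)"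
    unfolding FDR_def
    \<comment> \<open>Only the nonnegative upper bound is shown integrable: a non-integrable left
      integrand would have integral 0 by convention, which the bound still dominates.\<close>
    by (rule integral_mono')
      (use int assms(3) FDP_le_null_rejection[OF assms(2,3) sub] in \<open>auto simp: less_imp_le\<close>)
  also have "\<dots> = \<epsilon> + (\<integral>p. ?F (null_coords ?N p) \<partial>law P)"
    using int by (simp add: prob_space)
  also have "(\<integral>p. ?F (null_coords ?N p) \<partial>law P) = FDR (\<alpha> / \<epsilon>) (null_struct P)"
  proof -
    have "FDP (\<alpha> / \<epsilon>) (card ?N) {1..card ?N} = ?F"
      using assms(2,3) FDP_all_null[of "\<alpha> / \<epsilon>" "card ?N"] by auto
    then have "FDR (\<alpha> / \<epsilon>) (null_struct P)
        = integral\<^sup>L (distr (law P) (unit_cube (card ?N)) (null_coords ?N)) ?F"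
      by (simp only: FDR_def null_struct_def pval_struct.simps)
    then show ?thesis
      by (simp only: integral_distr[OF meas F])
  qed
  finally show ?thesis .
qed

section \<open>Passage to the limit\<close>

text \<open>In the extended nonnegative reals 0 is the least element, so a zero limsup forces a zero
  liminf.\<close>

lemma FDR_consistent_iff_tendsto:
  "FDR_consistent C \<longleftrightarrow> ((\<lambda>\<alpha>. SUP P\<in>C. ennreal (FDR \<alpha> P)) \<longlongrightarrow> 0) (at_right 0)"
proof
  assume *: "FDR_consistent C"
  let ?f = "\<lambda>\<alpha>. SUP P\<in>C. ennreal (FDR \<alpha> P)"
  have "Liminf (at_right 0) ?f \<le> Limsup (at_right 0) ?f"
    by (rule Liminf_le_Limsup) simp
  with * show "(?f \<longlongrightarrow> 0) (at_right 0)"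
    by (intro Liminf_eq_Limsup) (auto simp: FDR_consistent_def)
qed (auto simp: FDR_consistent_def intro: lim_imp_Limsup)

theorem theorem5:
  fixes C :: "pval_struct set"
  assumes "\<And>P. P \<in> C \<Longrightarrow> pval_structure P"
    and "FDR_consistent (null_struct ` C)"
  shows "FDR_consistent C"
proof -
  let ?f = "\<lambda>\<alpha>. SUP P\<in>C. ennreal (FDR \<alpha> P)"
  let ?g = "\<lambda>\<alpha>. SUP P\<in>null_struct ` C. ennreal (FDR \<alpha> P)"
  \<comment> \<open>The square root approaches 0 through positive values, so the one-sided limit of
    \<open>?g\<close> can be composed with it.\<close>
  have sqrt0: "filterlim sqrt (at_right 0) (at_right 0)"
    unfolding filterlim_at
    by (auto simp: eventually_at_filter intro!: tendsto_eq_intros)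
  have "((\<lambda>\<alpha>. ennreal (sqrt \<alpha>) + ?g (sqrt \<alpha>)) \<longlongrightarrow> ennreal 0 + 0) (at_right 0)"
  proof (intro tendsto_add tendsto_ennrealI)
    show "(sqrt \<longlongrightarrow> 0) (at_right 0)"
      using sqrt0 by (simp add: filterlim_at)
    show "((\<lambda>\<alpha>. ?g (sqrt \<alpha>)) \<longlongrightarrow> 0) (at_right 0)"
      using assms(2) sqrt0 unfolding FDR_consistent_iff_tendsto by (rule filterlim_compose)
  qed
  then have lim: "((\<lambda>\<alpha>. ennreal (sqrt \<alpha>) + ?g (sqrt \<alpha>)) \<longlongrightarrow> 0) (at_right 0)"
    by simp
  have le: "?f \<alpha> \<le> ennreal (sqrt \<alpha>) + ?g (sqrt \<alpha>)" if "0 < \<alpha>" for \<alpha>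
  proof (rule SUP_least)
    fix P assume P: "P \<in> C"
    \<comment> \<open>With \<epsilon> equal to \<open>sqrt \<alpha>\<close>, the enlarged level
      \<open>\<alpha> / \<epsilon>\<close> is again \<open>sqrt \<alpha>\<close>.\<close>
    have "FDR \<alpha> P \<le> sqrt \<alpha> + FDR (sqrt \<alpha>) (null_struct P)"
      using FDR_le_null_struct[OF assms(1)[OF P] that, of "sqrt \<alpha>"] that
      by (simp add: real_div_sqrt)
    then have "ennreal (FDR \<alpha> P) \<le> ennreal (sqrt \<alpha> + FDR (sqrt \<alpha>) (null_struct P))"
      by (rule ennreal_leI)
    also have "\<dots> = ennreal (sqrt \<alpha>) + ennreal (FDR (sqrt \<alpha>) (null_struct P))"
      \<comment> \<open>Splitting the sum requires both terms nonnegative; the FDR integrates a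
        nonnegative ratio.\<close>
      using that by (intro ennreal_plus) (auto simp: FDR_def FDP_def)
    also have "\<dots> \<le> ennreal (sqrt \<alpha>) + ?g (sqrt \<alpha>)"
      using P by (intro add_left_mono SUP_upper) auto
    finally show "ennreal (FDR \<alpha> P) \<le> ennreal (sqrt \<alpha>) + ?g (sqrt \<alpha>)" .
  qed
  show ?thesis
    unfolding FDR_consistent_iff_tendsto
    by (rule tendsto_sandwich[OF _ _ tendsto_const lim])
      (auto simp: eventually_at_filter intro!: always_eventually le)
qed

end
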